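(* $C_3(2)=2$. That is, $\limsup_{t\to\infty} \frac{N_3(t,2)}{\log_2 t} = 2$, where $N_3(t,2)$ is the minimal worst-case total number of tests needed to find both defective elements among $t$ samples by an algorithm using at most $3$ stages.
   Context: Group testing model: there are $t$ samples, indexed by $[t]=\{1,\dots,t\}$, among which an unknown set $S_{un}$ of exactly $s$ samples is defective. A test is performed on a chosen subset $T\subseteq[t]$; its outcome is positive (1) if $T\cap S_{un}\neq\emptyset$ and negative (0) otherwise; outcomes are always correct (noiseless). A $p$-stage algorithm is divided into $p$ stages; the tests of stage $i$ are all chosen before any test of stage $i$ is performed, and may depend on the outcomes of all tests from stages $1,\dots,i-1$. The algorithm must determine $S_{un}$ exactly for every possible $S_{un}$ with $|S_{un}|=s$. $N_p(t,s)$ denotes the minimal, over all $p$-stage algorithms, worst-case (over $S_{un}$) total number of tests, and $C_p(s)=\limsup_{t\to\infty} N_p(t,s)/\log_2 t$. *)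

theory Defs
  imports Complex_Main "HOL-Library.Liminf_Limsup" "HOL-Library.Extended_Real"
begin

text \<open>A p-stage algorithm: alg i h is the list of tests (subsets of samples) of stage i,
  chosen as a function of the outcome history h of stages 0..i-1
  (h is a list whose j-th entry is the outcome vector of stage j).\<close>
type_synonym alg = "nat \<Rightarrow> bool list list \<Rightarrow> nat set list"

definition outcome :: "nat set \<Rightarrow> nat set \<Rightarrow> bool" where
  "outcome S T \<longleftrightarrow> T \<inter> S \<noteq> {}"

fun hist :: "alg \<Rightarrow> nat set \<Rightarrow> nat \<Rightarrow> bool list list" where
  "hist A S 0 = []"
| "hist A S (Suc i) = hist A S i @ [map (outcome S) (A i (hist A S i))]"

definition cands :: "nat \<Rightarrow> nat \<Rightarrow> nat set set" where
  "cands t s = {S. S \<subseteq> {1..t} \<and> card S = s}"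

definition valid_alg :: "nat \<Rightarrow> nat \<Rightarrow> nat \<Rightarrow> alg \<Rightarrow> bool" where
  "valid_alg p t s A \<longleftrightarrow>
     (\<forall>i<p. \<forall>h. \<forall>T\<in>set (A i h). T \<subseteq> {1..t}) \<and>
     (\<forall>S\<in>cands t s. \<forall>S'\<in>cands t s. hist A S p = hist A S' p \<longrightarrow> S = S')"

definition num_tests :: "nat \<Rightarrow> alg \<Rightarrow> nat set \<Rightarrow> nat" where
  "num_tests p A S = sum_list (map length (hist A S p))"

definition worst_tests :: "nat \<Rightarrow> nat \<Rightarrow> nat \<Rightarrow> alg \<Rightarrow> nat" where
  "worst_tests p t s A = Sup (num_tests p A ` cands t s)"

definition N :: "nat \<Rightarrow> nat \<Rightarrow> nat \<Rightarrow> nat" where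
  "N p t s = Inf (worst_tests p t s ` {A. valid_alg p t s A})"

definition C :: "nat \<Rightarrow> nat \<Rightarrow> ereal" where
  "C p s = limsup (\<lambda>t. ereal (real (N p t s) / log 2 (real t)))"

end

theory Submission
  imports Defs "HOL-Library.FuncSet" "HOL-Real_Asymp.Real_Asymp"
begin

text \<open>
  The lower bound is the information bound \<open>2 ^ N \<ge> t choose 2\<close>.

  For the upper bound, two stages suffice. Encode the samples by random subsets \<open>f j\<close>, all of the
  same size \<open>w\<close>, of a set of \<open>M = (2 + \<epsilon>) log\<^sub>2 t\<close> tests; the first stage then reveals the union
  \<open>Y = f i \<union> f j\<close> of the codewords of the two defectives. If every test were put in a codeword
  independently with probability \<open>p = 1 - 1 / \<surd>2\<close>, the union of two codewords would be uniformly
  distributed, so for a suitable \<open>w\<close> each \<open>Y\<close> is the union of two random codewords with probability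
  at most \<open>2 ^ -M\<close> up to polynomial factors, and it completes a given codeword with probability at
  most \<open>2 ^ -(M/2)\<close> up to polynomial factors. A union bound over \<open>Y\<close> shows that some code has, for
  every \<open>Y\<close>, no large matching and no large star in the graph of pairs with union \<open>Y\<close>. This graph
  therefore touches boundedly many samples, which are tested individually in the second stage.
\<close>

section \<open>Counting functions: the union bound for random codes\<close>

text \<open>For uniformly random \<open>f\<close> the values at distinct points are independent and
  uniform, so they land in \<open>R\<close> with probability at most
  \<open>card R / card W ^ length js\<close>. The denominators are multiplied out to stay in
  \<open>nat\<close>.\<close>

lemma card_functions_with_values_in:
  assumes "finite I" "finite W" "finite R" "distinct js" "set js \<subseteq> I"
  shows "card {f \<in> I \<rightarrow>\<^sub>E W. map f js \<in> R} * card W ^ length js \<le> card R * card W ^ card I"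
proof -
  let ?F = "{f \<in> I \<rightarrow>\<^sub>E W. map f js \<in> R}" and ?J = "I - set js"
  let ?g = "\<lambda>f. (map f js, restrict f ?J)"
  have "inj_on ?g ?F"
  proof (rule inj_onI)
    fix f f' assume f: "f \<in> ?F" and f': "f' \<in> ?F" and eq: "?g f = ?g f'"
    show "f = f'"
    proof (rule PiE_ext[of f I "\<lambda>_. W" f'])
      fix i assume "i \<in> I"
      show "f i = f' i"
      proof (cases "i \<in> set js")
        case True
        with eq show ?thesis by auto
      next
        case False
        from eq have "restrict f ?J i = restrict f' ?J i" by simp
        with False \<open>i \<in> I\<close> show ?thesis by simp
      qed
    qed (use f f' in auto)
  qed
  moreover have "?g ` ?F \<subseteq> R \<times> (?J \<rightarrow>\<^sub>E W)" by auto
  ultimately have "card ?F \<le> card (R \<times> (?J \<rightarrow>\<^sub>E W))"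
    using assms by (intro card_inj_on_le[of ?g]) (auto intro!: finite_PiE)
  also have "\<dots> = card R * card W ^ card ?J"
    using assms by (simp add: card_cartesian_product card_PiE)
  finally have "card ?F * card W ^ length js \<le> card R * (card W ^ card ?J * card W ^ length js)"
    by (simp add: mult.assoc mult_le_mono1 flip: mult.assoc)
  also have "card W ^ card ?J * card W ^ length js = card W ^ card I"
  proof -
    have "card (set js) = length js" using assms(4) by (rule distinct_card)
    moreover have "card (set js) \<le> card I" using assms by (intro card_mono)
    ultimately have "card ?J + length js = card I" using assms by (simp add: card_Diff_subset)
    then show ?thesis by (simp flip: power_add)
  qed
  finally show ?thesis .
qed

text \<open>Union bound over the at most \<open>card I ^ r\<close> index lists.\<close>

lemma card_functions_hitting:
  assumes "finite I" "finite W" "finite R"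
  shows "card {f \<in> I \<rightarrow>\<^sub>E W. \<exists>js. distinct js \<and> set js \<subseteq> I \<and> length js = r \<and> map f js \<in> R} * card W ^ r
    \<le> card I ^ r * card R * card W ^ card I"
proof -
  let ?J = "{js. distinct js \<and> set js \<subseteq> I \<and> length js = r}"
  let ?F = "\<lambda>js. {f \<in> I \<rightarrow>\<^sub>E W. map f js \<in> R}"
  have sub: "?J \<subseteq> {js. set js \<subseteq> I \<and> length js = r}" by auto
  have finJ: "finite ?J" by (rule finite_subset[OF sub finite_lists_length_eq[OF assms(1)]])
  have cardJ: "card ?J \<le> card I ^ r"
    using card_mono[OF finite_lists_length_eq[OF assms(1)] sub] card_lists_length_eq[OF assms(1)] by simp
  have "{f \<in> I \<rightarrow>\<^sub>E W. \<exists>js. distinct js \<and> set js \<subseteq> I \<and> length js = r \<and> map f js \<in> R} = (\<Union>js\<in>?J. ?F js)"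
    by auto
  then have "card {f \<in> I \<rightarrow>\<^sub>E W. \<exists>js. distinct js \<and> set js \<subseteq> I \<and> length js = r \<and> map f js \<in> R} * card W ^ r
     \<le> (\<Sum>js\<in>?J. card (?F js)) * card W ^ r"
    using card_UN_le[OF finJ, of ?F] by simp
  also have "\<dots> = (\<Sum>js\<in>?J. card (?F js) * card W ^ r)" by (simp add: sum_distrib_right)
  also have "\<dots> \<le> (\<Sum>js\<in>?J. card R * card W ^ card I)"
    using card_functions_with_values_in[OF assms] by (intro sum_mono) auto
  also have "\<dots> \<le> card I ^ r * (card R * card W ^ card I)" using cardJ by simp
  finally show ?thesis by (simp add: mult.assoc)
qed

section \<open>Binomial estimates\<close>

lemma binomial_term_le:
  fixes x y :: real
  assumes "x \<ge> 0" "y \<ge> 0"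
  shows "of_nat (n choose i) * x ^ i * y ^ (n - i) \<le> (x + y) ^ n"
proof (cases "i \<le> n")
  case True
  have "of_nat (n choose i) * x ^ i * y ^ (n - i) \<le> (\<Sum>k\<le>n. of_nat (n choose k) * x ^ k * y ^ (n - k))"
    using True assms by (intro member_le_sum) auto
  then show ?thesis by (simp add: binomial_ring)
qed (use assms in \<open>simp add: binomial_eq_0\<close>)

text \<open>One of the \<open>n + 1\<close> terms of the binomial expansion is at least their
  average. With \<open>x + y = 1\<close> this finds a size that a random set has with probability at
  least \<open>1 / (n + 1)\<close>.\<close>

lemma ex_large_binomial_term:
  fixes x y :: real
  assumes "x \<ge> 0" "y \<ge> 0"
  shows "\<exists>w\<le>n. (x + y) ^ n \<le> (n + 1) * (of_nat (n choose w) * x ^ w * y ^ (n - w))"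
proof (rule ccontr)
  assume "\<not> ?thesis"
  then have "(real n + 1) * (of_nat (n choose k) * x ^ k * y ^ (n - k)) < (x + y) ^ n" if "k \<le> n" for k
    using that by (meson not_le)
  then have "(\<Sum>k\<le>n. of_nat (n choose k) * x ^ k * y ^ (n - k)) < (\<Sum>k\<le>n. (x + y) ^ n / (real n + 1))"
    by (intro sum_strict_mono) (auto simp: field_simps)
  also have "\<dots> = (x + y) ^ n" by (simp add: field_simps)
  finally show False by (simp add: binomial_ring)
qed

section \<open>Equal-size sets with a prescribed union\<close>

definition weight_sets :: "nat \<Rightarrow> nat \<Rightarrow> nat set set" where
  "weight_sets M w = {A. A \<subseteq> {..<M} \<and> card A = w}"

definition union_pairs :: "nat \<Rightarrow> nat \<Rightarrow> nat set \<Rightarrow> (nat set \<times> nat set) set" where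
  "union_pairs M w Y = {(A, B). A \<in> weight_sets M w \<and> B \<in> weight_sets M w \<and> A \<union> B = Y}"

definition union_partners :: "nat \<Rightarrow> nat \<Rightarrow> nat set \<Rightarrow> nat set \<Rightarrow> nat set set" where
  "union_partners M w Y A = {B \<in> weight_sets M w. A \<union> B = Y}"

lemma finite_weight_sets [simp]: "finite (weight_sets M w)"
  by (rule finite_subset[of _ "Pow {..<M}"]) (auto simp: weight_sets_def)

lemma card_weight_sets: "card (weight_sets M w) = M choose w"
  using n_subsets[of "{..<M}" w] by (simp add: weight_sets_def)

lemma finite_union_pairs [simp]: "finite (union_pairs M w Y)"
  by (rule finite_subset[of _ "weight_sets M w \<times> weight_sets M w"]) (auto simp: union_pairs_def)

lemma finite_union_partners [simp]: "finite (union_partners M w Y A)"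
  by (simp add: union_partners_def)

text \<open>Outside \<open>A\<close> a partner must agree with \<open>Y\<close>, so only its trace
  on \<open>A\<close> is free.\<close>

lemma inj_on_Int_union_partners: "inj_on (\<lambda>B. B \<inter> A) (union_partners M w Y A)"
  by (rule inj_onI) (auto simp: union_partners_def)

lemma card_union_partners_le:
  assumes A: "A \<in> weight_sets M w"
  shows "card (union_partners M w Y A) \<le> 2 ^ w"
proof -
  have fin: "finite A" using A by (auto simp: weight_sets_def intro: finite_subset)
  have "card (union_partners M w Y A) \<le> card (Pow A)"
    using fin by (intro card_inj_on_le[OF inj_on_Int_union_partners]) auto
  then show ?thesis using A fin by (simp add: card_Pow weight_sets_def)
qed

text \<open>By inclusion-exclusion the trace of a partner on \<open>A\<close> has size
  \<open>2 * w - card Y\<close>.\<close>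

lemma card_union_partners_le_choose:
  assumes A: "A \<in> weight_sets M w"
  shows "card (union_partners M w Y A) \<le> (w choose (2 * w - card Y))"
proof -
  have fin: "finite A" and cA: "card A = w" using A by (auto simp: weight_sets_def intro: finite_subset)
  have "(\<lambda>B. B \<inter> A) ` union_partners M w Y A \<subseteq> {X. X \<subseteq> A \<and> card X = 2 * w - card Y}"
  proof clarify
    fix B assume B: "B \<in> union_partners M w Y A"
    then have "finite B" "card B = w" "A \<union> B = Y"
      by (auto simp: union_partners_def weight_sets_def intro: finite_subset)
    then have "card (B \<inter> A) = 2 * w - card Y"
      using card_Un_Int[of A B] fin cA by (simp add: Int_commute)
    then show "B \<inter> A \<subseteq> A \<and> card (B \<inter> A) = 2 * w - card Y" by simp
  qed
  then have "card (union_partners M w Y A) \<le> card {X. X \<subseteq> A \<and> card X = 2 * w - card Y}"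
    using fin by (intro card_inj_on_le[OF inj_on_Int_union_partners]) auto
  then show ?thesis using n_subsets[OF fin] cA by simp
qed

text \<open>Choose \<open>A\<close> inside \<open>Y\<close>, then a partner of
  \<open>A\<close>.\<close>

lemma card_union_pairs_le:
  "card (union_pairs M w Y) \<le> (card Y choose w) * (w choose (2 * w - card Y))"
proof (cases "union_pairs M w Y = {}")
  case False
  then have fin: "finite Y" and "Y \<subseteq> {..<M}"
    by (auto simp: union_pairs_def weight_sets_def intro: finite_subset)
  let ?S = "{A. A \<subseteq> Y \<and> card A = w}"
  have S: "?S \<subseteq> weight_sets M w" using \<open>Y \<subseteq> _\<close> by (auto simp: weight_sets_def)
  have "union_pairs M w Y \<subseteq> (SIGMA A:?S. union_partners M w Y A)"
    by (auto simp: union_pairs_def union_partners_def weight_sets_def)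
  then have "card (union_pairs M w Y) \<le> card (SIGMA A:?S. union_partners M w Y A)"
    using fin by (intro card_mono) auto
  also have "\<dots> = (\<Sum>A\<in>?S. card (union_partners M w Y A))"
    using fin by (intro card_SigmaI) auto
  also have "\<dots> \<le> (\<Sum>A\<in>?S. (w choose (2 * w - card Y)))"
    using S by (intro sum_mono card_union_partners_le_choose) auto
  also have "\<dots> = (card Y choose w) * (w choose (2 * w - card Y))"
    using n_subsets[OF fin] by simp
  finally show ?thesis .
qed simp

text \<open>The weight of a set is its probability when each element is chosen with probability \<open>p\<close>;
  the bound is exactly the probability that two such random sets have union \<open>Y\<close>.\<close>

lemma card_union_pairs_weighted:
  fixes p q :: real
  assumes q: "q > 0" "p > 0" "p + q = 1" "q\<^sup>2 = 1/2"
    and w: "w \<le> M"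
  shows "card (union_pairs M w Y) * (p ^ w * q ^ (M - w))\<^sup>2 \<le> 1 / 2 ^ M"
proof (cases "union_pairs M w Y = {}")
  case False
  then obtain A B where "A \<subseteq> {..<M}" "B \<subseteq> {..<M}" "card A = w" "card B = w" "A \<union> B = Y"
    by (auto simp: union_pairs_def weight_sets_def)
  then have y: "card Y \<le> 2 * w" "w \<le> card Y"
    using card_Un_le[of A B] card_mono[of Y A] by (auto intro: finite_subset)
  define y where "y = card Y"
  \<comment> \<open>For any pair in question, \<open>a\<close> is the size of \<open>Y - A\<close>
    and \<open>b\<close> that of \<open>A \<inter> B\<close>.\<close>
  obtain a where a: "y = w + a" using y y_def le_Suc_ex by blast
  obtain b where b: "w = a + b" using y y_def a by (metis add_le_cancel_left le_Suc_ex mult_2)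
  obtain c where c: "M = w + c" using w le_Suc_ex by blast
  \<comment> \<open>Both sides are 1/2, since \<open>p * (1 + q) = (1 - q) * (1 + q)\<close>. This
    identity makes the final bound independent of \<open>card Y\<close>.\<close>
  have pq: "p * (1 + q) = q * q" 
    using q(3,4) by (simp add: power2_eq_square algebra_simps)
       (smt (verit) distrib_left mult.commute mult_cancel_left2)
  have 1: "(y choose w) * q ^ a \<le> (1 + q) ^ y"
    using binomial_term_le[of 1 q y w] q a by simp
  have 2: "(w choose b) * p ^ b * q ^ a \<le> 1"
    using binomial_term_le[of p q w b] q b by simp
  have bb: "2 * w - y = b" using a b by simp
  have "card (union_pairs M w Y) \<le> (y choose w) * (w choose b)"
    using card_union_pairs_le[of M w Y] bb by (simp add: y_def)
  then have "real (card (union_pairs M w Y)) \<le> real ((y choose w) * (w choose b))"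
    by (rule of_nat_mono)
  then have "card (union_pairs M w Y) * (p ^ w * q ^ (M - w))\<^sup>2
      \<le> real ((y choose w) * (w choose b)) * (p ^ w * q ^ (M - w))\<^sup>2"
    by (rule mult_right_mono) simp
  also have "\<dots> = real (y choose w) * real (w choose b) * (p ^ w * q ^ c)\<^sup>2"
    using c by simp
  \<comment> \<open>The factors are regrouped into the two binomial terms above; the powers of
    \<open>p\<close> match because \<open>y + b = 2 * w\<close>.\<close>
  also have "\<dots> = ((y choose w) * q ^ a) * ((w choose b) * p ^ b * q ^ a) * (p ^ y * (q ^ c)\<^sup>2) / (q ^ a)\<^sup>2"
    using q(1) a b by (simp add: power2_eq_square power_add mult_2 field_simps)
  also have "\<dots> \<le> (1 + q) ^ y * 1 * (p ^ y * (q ^ c)\<^sup>2) / (q ^ a)\<^sup>2"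
    using 1 2 q by (intro divide_right_mono mult_right_mono mult_mono) auto
  also have "\<dots> = (p * (1 + q)) ^ y * (q ^ c)\<^sup>2 / (q ^ a)\<^sup>2"
    by (simp add: power_mult_distrib)
  also have "\<dots> = (q\<^sup>2) ^ M"
    unfolding pq using q(1) a b c by (simp add: power2_eq_square power_add mult_2 field_simps)
  finally show ?thesis by (simp add: q power_one_over)
qed simp

text \<open>Take a size \<open>w\<close> that is likely when elements are chosen with probability
  \<open>p = 1 - 1 / sqrt 2\<close>. Then uniform \<open>w\<close>-sets lose only a factor
  \<open>M + 1\<close> per set against independent choices: a random pair has union \<open>Y\<close>
  with probability at most \<open>(M + 1)^2 / 2 ^ M\<close>, and a fixed set has at most a fraction
  \<open>(M + 1) / 2 powr (M / 2)\<close> of all \<open>w\<close>-sets as partners.\<close>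

lemma ex_good_weight:
  "\<exists>w\<le>M. (\<forall>Y. real (card (union_pairs M w Y)) * 2 ^ M \<le> (real ((M + 1) * (M choose w)))\<^sup>2)
    \<and> 2 ^ w * 2 powr (M / 2) \<le> real ((M + 1) * (M choose w))"
proof -
  define q :: real where "q = 1 / sqrt 2"
  define p :: real where "p = 1 - q"
  have q: "q > 0" "q\<^sup>2 = 1/2" "q < 1" by (simp_all add: q_def power_divide)
  have p: "p > 0" "p + q = 1" using q by (simp_all add: p_def)
  \<comment> \<open>Equivalent to \<open>q \<ge> 2 / 3\<close>. It lets the crude count
    \<open>2 ^ w\<close> of partners suffice: \<open>2 ^ w * x\<close> is then at most
    \<open>q ^ M\<close>.\<close>
  have "2 * p \<le> q"
  proof -
    have "(2 / 3)\<^sup>2 \<le> q\<^sup>2" unfolding q(2) by (simp add: power2_eq_square)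
    then have "2 / 3 \<le> q" using q(1) power2_le_imp_le[of "2/3" q] by simp
    then show ?thesis by (simp add: p_def)
  qed
  obtain w where w: "w \<le> M" and le: "1 \<le> (real M + 1) * ((M choose w) * p ^ w * q ^ (M - w))"
    using ex_large_binomial_term[of p q M] p q by auto
  \<comment> \<open>The probability of one particular \<open>w\<close>-set under independent
    choices.\<close>
  define x where "x = p ^ w * q ^ (M - w)"
  define D where "D = real ((M + 1) * (M choose w))"
  have x: "x > 0" using p q by (simp add: x_def)
  have Dx: "1 \<le> D * x" using le by (simp add: x_def D_def mult.assoc distrib_right)
  have "real (card (union_pairs M w Y)) * 2 ^ M \<le> D\<^sup>2" for Y
  proof -
    let ?u = "real (card (union_pairs M w Y)) * 2 ^ M"
    have "?u * x\<^sup>2 \<le> 1"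
      using card_union_pairs_weighted[OF q(1) p q(2) w, of Y] by (simp add: x_def field_simps)
    also have "\<dots> \<le> (D * x)\<^sup>2" using Dx by (simp add: one_le_power)
    finally show ?thesis using x by (simp add: power_mult_distrib)
  qed
  moreover have "2 ^ w * 2 powr (M / 2) \<le> D"
  proof -
    have qM: "2 powr (M / 2) * q ^ M = 1"
    proof -
      have "2 powr (M / 2) = sqrt 2 ^ M"
        by (simp add: powr_half_sqrt[symmetric] powr_powr flip: powr_realpow)
      then show ?thesis by (simp add: q_def power_divide)
    qed
    have "2 ^ w * x = (2 * p) ^ w * q ^ (M - w)" by (simp add: x_def power_mult_distrib)
    also have "\<dots> \<le> q ^ w * q ^ (M - w)"
      using \<open>2 * p \<le> q\<close> p q by (intro mult_right_mono power_mono) auto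
    also have "\<dots> = q ^ M" using w by (simp flip: power_add)
    finally have "2 ^ w * x * 2 powr (M / 2) \<le> q ^ M * 2 powr (M / 2)" by (intro mult_right_mono) auto
    also have "\<dots> \<le> D * x" using qM Dx by (simp add: mult.commute)
    finally show ?thesis using x by (simp add: mult.commute mult.left_commute)
  qed
  ultimately show ?thesis using w unfolding D_def by blast
qed

section \<open>A random code without large matchings or stars\<close>

text \<open>Codewords along \<open>m\<close> edges with a common union \<open>Y\<close>, all first
  endpoints listed before all second ones. Codewords may repeat: disjointness of the edges is later
  imposed on the indices.\<close>

definition matching_tuples :: "nat \<Rightarrow> nat \<Rightarrow> nat \<Rightarrow> nat set list set" where
  "matching_tuples M w m = (\<Union>Y\<in>Pow {..<M}.
     (\<lambda>ps. map fst ps @ map snd ps) ` {ps. set ps \<subseteq> union_pairs M w Y \<and> length ps = m})"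

text \<open>The centre comes first, so the lists have length \<open>k + 1\<close>.\<close>

definition star_tuples :: "nat \<Rightarrow> nat \<Rightarrow> nat \<Rightarrow> nat set list set" where
  "star_tuples M w k = (\<Union>Y\<in>Pow {..<M}. \<Union>A\<in>weight_sets M w.
     (\<lambda>Bs. A # Bs) ` {Bs. set Bs \<subseteq> union_partners M w Y A \<and> length Bs = k})"

lemma finite_matching_tuples: "finite (matching_tuples M w m)"
  by (simp add: matching_tuples_def finite_lists_length_eq)

lemma finite_star_tuples: "finite (star_tuples M w k)"
  by (simp add: star_tuples_def finite_lists_length_eq)

lemma card_matching_tuples_le:
  fixes c :: real
  assumes "\<And>Y. real (card (union_pairs M w Y)) \<le> c"
  shows "card (matching_tuples M w m) \<le> 2 ^ M * c ^ m"
proof -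
  let ?L = "\<lambda>Y. {ps. set ps \<subseteq> union_pairs M w Y \<and> length ps = m}"
  have "card (matching_tuples M w m) \<le> (\<Sum>Y\<in>Pow {..<M}. card (?L Y))"
    unfolding matching_tuples_def
    by (rule order_trans[OF card_UN_le sum_mono]) (auto intro!: card_image_le finite_lists_length_eq)
  also have "real \<dots> = (\<Sum>Y\<in>Pow {..<M}. real (card (union_pairs M w Y)) ^ m)"
    by (simp add: card_lists_length_eq)
  also have "\<dots> \<le> (\<Sum>Y\<in>Pow {..<M}. c ^ m)"
    using assms by (intro sum_mono power_mono) auto
  finally show ?thesis by (simp add: card_Pow)
qed

lemma card_star_tuples_le:
  "card (star_tuples M w k) \<le> 2 ^ M * ((M choose w) * (2 ^ w) ^ k)"
proof -
  let ?L = "\<lambda>Y A. {Bs. set Bs \<subseteq> union_partners M w Y A \<and> length Bs = k}"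
  have "card (star_tuples M w k) \<le> (\<Sum>Y\<in>Pow {..<M}. \<Sum>A\<in>weight_sets M w. card (?L Y A))"
    unfolding star_tuples_def
    by (rule order_trans[OF card_UN_le sum_mono[OF order_trans[OF card_UN_le sum_mono]]])
       (auto intro!: card_image_le finite_lists_length_eq)
  also have "\<dots> \<le> (\<Sum>Y\<in>Pow {..<M}. \<Sum>A\<in>weight_sets M w. (2 ^ w) ^ k)"
    by (intro sum_mono) (auto simp: card_lists_length_eq intro!: power_mono card_union_partners_le)
  finally show ?thesis by (simp add: card_Pow card_weight_sets)
qed

text \<open>First-moment method. For fixed \<open>Y\<close>, \<open>v\<close> bounds the expected
  number of samples completing a given codeword, and \<open>v\<^sup>2\<close> the expected number of
  ordered edges. With \<open>2 ^ M\<close> choices of \<open>Y\<close>, the two summands of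
  \<open>small\<close> bound the probabilities of a matching with \<open>m\<close> edges and of a
  star with \<open>k\<close> leaves; the factor \<open>card I\<close> counts centres.\<close>

lemma ex_code_avoiding:
  fixes I :: "nat set" and v :: real and M :: nat
  defines "v \<equiv> real (card I) * (M + 1) / 2 powr (M / 2)"
  assumes fin: "finite I"
    and small: "2 ^ M * v ^ (2 * m) + card I * 2 ^ M * v ^ k < 1"
  shows "\<exists>w f. f \<in> I \<rightarrow> weight_sets M w
    \<and> (\<forall>js. distinct js \<and> set js \<subseteq> I \<longrightarrow> map f js \<notin> matching_tuples M w m \<and> map f js \<notin> star_tuples M w k)"
proof -
  obtain w where w: "w \<le> M"
    and pairs: "\<And>Y. real (card (union_pairs M w Y)) * 2 ^ M \<le> (real ((M + 1) * (M choose w)))\<^sup>2"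
    and star: "2 ^ w * 2 powr (M / 2) \<le> real ((M + 1) * (M choose w))"
    using ex_good_weight by blast
  define W where "W = weight_sets M w"
  define D where "D = M choose w"
  define t where "t = card I"
  have cW: "card W = D" and finW: "finite W" by (simp_all add: W_def D_def card_weight_sets)
  have D: "D > 0" using w by (simp add: D_def zero_less_binomial)
  let ?H = "\<lambda>R r. {f \<in> I \<rightarrow>\<^sub>E W. \<exists>js. distinct js \<and> set js \<subseteq> I \<and> length js = r \<and> map f js \<in> R}"
  have bound: "card (?H R r) \<le> real t ^ r * card R / real D ^ r * real D ^ t" if "finite R" for R r
  proof -
    have "card (?H R r) * D ^ r \<le> t ^ r * card R * D ^ t"
      using card_functions_hitting[OF fin finW that, of r] by (simp add: cW t_def)
    then have "real (card (?H R r) * D ^ r) \<le> real (t ^ r * card R * D ^ t)" by (rule of_nat_mono)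
    then show ?thesis using D by (simp add: field_simps)
  qed
  define s :: real where "s = 2 powr (M / 2)"
  have s: "s > 0" "s\<^sup>2 = 2 ^ M"
    by (simp_all add: s_def power2_eq_square powr_realpow flip: powr_add)
  have s2m: "s ^ (2 * m) = 2 ^ (M * m)" by (simp add: power_mult s(2))
  have v: "v = real t * (real M + 1) / s" by (simp add: v_def t_def s_def add.commute)
  have b1: "real t ^ (2 * m) * card (matching_tuples M w m) / real D ^ (2 * m) \<le> 2 ^ M * v ^ (2 * m)"
  proof -
    have "card (matching_tuples M w m) \<le> 2 ^ M * (((real M + 1) * D / s)\<^sup>2) ^ m"
      using pairs s by (intro card_matching_tuples_le) (simp add: power_divide field_simps D_def)
    then have "card (matching_tuples M w m) * (real t ^ (2 * m) / real D ^ (2 * m)) 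
        \<le> 2 ^ M * (((real M + 1) * D / s)\<^sup>2) ^ m * (real t ^ (2 * m) / real D ^ (2 * m))"
      by (rule mult_right_mono) simp
    also have "\<dots> = 2 ^ M * v ^ (2 * m)"
      using D s by (simp add: v s2m power_mult[symmetric] power_mult_distrib power_divide)
    finally show ?thesis by (simp add: field_simps)
  qed
  have b2: "real t ^ (Suc k) * card (star_tuples M w k) / real D ^ (Suc k) \<le> t * 2 ^ M * v ^ k"
  proof -
    have "real (card (star_tuples M w k)) \<le> real (2 ^ M * (D * (2 ^ w) ^ k))"
      unfolding D_def by (rule of_nat_mono[OF card_star_tuples_le])
    also have "\<dots> = 2 ^ M * (real D * (2 ^ w) ^ k)" by simp
    also have "\<dots> \<le> 2 ^ M * (D * ((real M + 1) * D / s) ^ k)"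
      using star s by (intro mult_left_mono power_mono) (simp_all add: field_simps D_def s_def)
    finally have "card (star_tuples M w k) * (real t ^ Suc k / real D ^ Suc k)
        \<le> 2 ^ M * (D * ((real M + 1) * D / s) ^ k) * (real t ^ Suc k / real D ^ Suc k)"
      by (rule mult_right_mono) simp
    also have "\<dots> = t * 2 ^ M * v ^ k"
      using D s by (simp add: v power_mult_distrib power_divide)
    finally show ?thesis by (simp add: field_simps)
  qed
  let ?H1 = "?H (matching_tuples M w m) (2 * m)" and ?H2 = "?H (star_tuples M w k) (Suc k)"
  have "real (card (?H1 \<union> ?H2)) \<le> real (card ?H1) + real (card ?H2)"
    using card_Un_le[of ?H1 ?H2] by linarith
  also have "\<dots> \<le> 2 ^ M * v ^ (2 * m) * real D ^ t + t * 2 ^ M * v ^ k * real D ^ t"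
    using order_trans[OF bound[OF finite_matching_tuples] mult_right_mono[OF b1]]
      order_trans[OF bound[OF finite_star_tuples] mult_right_mono[OF b2]]
    by (intro add_mono) auto
  also have "\<dots> = (2 ^ M * v ^ (2 * m) + t * 2 ^ M * v ^ k) * real D ^ t" by (simp add: algebra_simps)
  also have "\<dots> < 1 * real D ^ t" using small D by (intro mult_strict_right_mono) (auto simp: t_def)
  also have "\<dots> = real (card (I \<rightarrow>\<^sub>E W))" using fin by (simp add: card_PiE cW t_def)
  finally have "card (?H1 \<union> ?H2) < card (I \<rightarrow>\<^sub>E W)" by linarith
  moreover have "finite (?H1 \<union> ?H2)"
    using fin finW by (intro finite_subset[OF _ finite_PiE[of I "\<lambda>_. W"]]) auto
  ultimately have "\<not> (I \<rightarrow>\<^sub>E W) \<subseteq> ?H1 \<union> ?H2"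
    using card_mono[of "?H1 \<union> ?H2" "I \<rightarrow>\<^sub>E W"] by linarith
  then obtain f where f: "f \<in> I \<rightarrow>\<^sub>E W" "f \<notin> ?H1" "f \<notin> ?H2" by blast
  show ?thesis
  proof (intro exI conjI allI impI)
    show "f \<in> I \<rightarrow> weight_sets M w" using f(1) by (auto simp: W_def)
  next
    fix js assume "distinct js \<and> set js \<subseteq> I"
    \<comment> \<open>Membership forces the length prescribed in \<open>?H1\<close> and
      \<open>?H2\<close>, so avoiding these two events covers all lists \<open>js\<close>.\<close>
    moreover have "length js = 2 * m" if "map f js \<in> matching_tuples M w m"
      using that by (auto simp: matching_tuples_def dest!: arg_cong[of _ _ length])
    moreover have "length js = Suc k" if "map f js \<in> star_tuples M w k"
      using that by (auto simp: star_tuples_def dest!: arg_cong[of _ _ length])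
    ultimately show "map f js \<notin> matching_tuples M w m" "map f js \<notin> star_tuples M w k"
      using f unfolding mem_Collect_eq by blast+
  qed
qed

section \<open>Few samples are compatible with a first-stage outcome\<close>

text \<open>A maximal matching in the graph of pairs with union \<open>Y\<close> is a vertex cover.\<close>

lemma few_candidates:
  fixes f :: "nat \<Rightarrow> nat set"
  assumes fin: "finite I" and f: "f \<in> I \<rightarrow> weight_sets M w"
    and no_matching: "\<And>js. distinct js \<Longrightarrow> set js \<subseteq> I \<Longrightarrow> map f js \<notin> matching_tuples M w m"
    and no_star: "\<And>js. distinct js \<Longrightarrow> set js \<subseteq> I \<Longrightarrow> map f js \<notin> star_tuples M w k"
  shows "\<exists>V. V \<subseteq> I \<and> card V \<le> 2 * m * (k + 1) \<and> (\<forall>i\<in>I. \<forall>j\<in>I. i \<noteq> j \<and> f i \<union> f j = Y \<longrightarrow> i \<in> V \<and> j \<in> V)"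
proof (cases "Y \<subseteq> {..<M}")
  case Y: True
  let ?verts = "\<lambda>ps :: (nat \<times> nat) list. map fst ps @ map snd ps"
  \<comment> \<open>\<open>P ps\<close> says that \<open>ps\<close> lists the edges of a
    matching.\<close>
  define P where "P ps \<longleftrightarrow> distinct (?verts ps) \<and> set (?verts ps) \<subseteq> I \<and> (\<forall>x\<in>set ps. f (fst x) \<union> f (snd x) = Y)" for ps
  have P_len: "length ps < m" if ps: "P ps" for ps
  proof (rule ccontr)
    assume "\<not> length ps < m"
    \<comment> \<open>Truncation to exactly \<open>m\<close> edges, as
      \<open>matching_tuples\<close> requires.\<close>
    define qs where "qs = take m ps"
    have len: "length qs = m" using \<open>\<not> _\<close> by (simp add: qs_def)
    have sub: "set qs \<subseteq> set ps" by (simp add: qs_def set_take_subset)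
    have dist: "distinct (?verts qs)"
      using ps sub unfolding P_def qs_def by (auto simp: take_map[symmetric] distinct_take dest!: in_set_takeD)
    have "set (?verts qs) \<subseteq> set (?verts ps)"
      using image_mono[OF sub, of fst] image_mono[OF sub, of snd] by auto
    then have vI: "set (?verts qs) \<subseteq> I" using ps unfolding P_def by (meson subset_trans)
    define rs where "rs = map (\<lambda>(i, j). (f i, f j)) qs"
    have "set rs \<subseteq> union_pairs M w Y"
    proof
      fix z assume "z \<in> set rs"
      then obtain i j where ij: "(i, j) \<in> set qs" and z: "z = (f i, f j)" by (auto simp: rs_def)
      have "i \<in> I" "j \<in> I" using vI ij by force+
      moreover have "(i, j) \<in> set ps" using sub ij by blast
      with ps have "f i \<union> f j = Y" unfolding P_def by fastforce
      ultimately show "z \<in> union_pairs M w Y" using f z by (auto simp: union_pairs_def)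
    qed
    moreover have "map f (?verts qs) = map fst rs @ map snd rs"
      by (simp add: rs_def case_prod_beta comp_def)
    ultimately have "map f (?verts qs) \<in> matching_tuples M w m"
      unfolding matching_tuples_def using Y len by (intro UN_I[of Y] image_eqI[of _ _ rs]) (auto simp: rs_def)
    with no_matching[OF dist vI] show False by blast
  qed
  have "P []" by (simp add: P_def)
  then obtain ps where ps: "P ps" and max: "\<And>qs. P qs \<Longrightarrow> length qs \<le> length ps"
    using ex_has_greatest_nat[of P "[]" length m] P_len by metis
  define X where "X = set (?verts ps)"
  have X: "X \<subseteq> I" using ps by (simp add: X_def P_def)
  have finX: "finite X" by (simp add: X_def)
  have cX: "card X \<le> 2 * m"
    using card_length[of "?verts ps"] P_len[OF ps] unfolding X_def by simp
  have cover: "i \<in> X \<or> j \<in> X" if "i \<in> I" "j \<in> I" "i \<noteq> j" "f i \<union> f j = Y" for i j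
  proof (rule ccontr)
    assume "\<not> ?thesis"
    then have "P ((i, j) # ps)" using ps that unfolding P_def X_def by auto
    from max[OF this] show False by simp
  qed
  define nb where "nb i = {j \<in> I. j \<noteq> i \<and> f i \<union> f j = Y}" for i
  have nb: "card (nb i) \<le> k" if i: "i \<in> I" for i
  proof (rule ccontr)
    assume "\<not> card (nb i) \<le> k"
    then obtain T where T: "T \<subseteq> nb i" "card T = k" using obtain_subset_with_card_n[of k "nb i"] by auto
    have finT: "finite T" using T fin finite_subset[of T I] by (auto simp: nb_def)
    then obtain js where js: "set js = T" "distinct js" using finite_distinct_list by blast
    have d: "distinct (i # js)" and I: "set (i # js) \<subseteq> I" using js T i by (auto simp: nb_def)
    have "map f js \<in> {Bs. set Bs \<subseteq> union_partners M w Y (f i) \<and> length Bs = k}"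
      using js T f distinct_card[OF js(2)] by (auto simp: union_partners_def nb_def)
    then have "map f (i # js) \<in> star_tuples M w k"
      unfolding star_tuples_def using Y f i
      by (intro UN_I[of Y] UN_I[of "f i"] image_eqI[of _ _ "map f js"]) auto
    with no_star[OF d I] show False by blast
  qed
  \<comment> \<open>Every edge has an endpoint in the cover \<open>X\<close>, and its other endpoint
    is a neighbour of that one.\<close>
  define V where "V = X \<union> (\<Union>i\<in>X. nb i)"
  have "card V \<le> card X + card (\<Union>i\<in>X. nb i)" unfolding V_def by (rule card_Un_le)
  also have "card (\<Union>i\<in>X. nb i) \<le> (\<Sum>i\<in>X. card (nb i))" using finX by (rule card_UN_le)
  also have "\<dots> \<le> (\<Sum>i\<in>X. k)" using nb X by (intro sum_mono) auto
  also have "card X + (\<Sum>i\<in>X. k) = card X * (k + 1)" by simp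
  also have "\<dots> \<le> 2 * m * (k + 1)" using cX by (intro mult_right_mono) auto
  finally have "card V \<le> 2 * m * (k + 1)" by simp
  moreover have "V \<subseteq> I" using X by (auto simp: V_def nb_def)
  moreover have "\<forall>i\<in>I. \<forall>j\<in>I. i \<noteq> j \<and> f i \<union> f j = Y \<longrightarrow> i \<in> V \<and> j \<in> V"
  proof (intro ballI impI)
    fix i j assume ij: "i \<in> I" "j \<in> I" "i \<noteq> j \<and> f i \<union> f j = Y"
    then have "i \<in> nb j" "j \<in> nb i" by (auto simp: nb_def)
    with cover[of i j] ij show "i \<in> V \<and> j \<in> V" by (auto simp: V_def)
  qed
  ultimately show ?thesis by blast
next
  case False
  then have "f i \<union> f j \<noteq> Y" if "i \<in> I" "j \<in> I" for i j
    using f that by (fastforce simp: weight_sets_def)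
  then show ?thesis by (intro exI[of _ "{}"]) auto
qed

section \<open>Outcome histories and the information bound\<close>

lemma concat_hist_prefix:
  assumes "i \<le> p"
  shows "\<exists>ys. concat (hist A S p) = concat (hist A S i) @ ys"
  using assms by (induction p rule: dec_induct) auto

text \<open>Equal histories up to stage \<open>i\<close> lead to the same tests in stage
  \<open>i\<close>, hence to outcome vectors of equal length, which can be cut off the front of the
  equal concatenations.\<close>

lemma hist_eqI:
  assumes eq: "concat (hist A S p) @ xs = concat (hist A S' p) @ xs'" and "i \<le> p"
  shows "hist A S i = hist A S' i"
  using \<open>i \<le> p\<close>
proof (induction i)
  case (Suc i)
  then have IH: "hist A S i = hist A S' i" by simp
  obtain ys ys' where "concat (hist A S p) = concat (hist A S (Suc i)) @ ys"
    "concat (hist A S' p) = concat (hist A S' (Suc i)) @ ys'"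
    using concat_hist_prefix[OF Suc.prems] by metis
  with eq IH have "map (outcome S) (A i (hist A S i)) @ ys @ xs = map (outcome S') (A i (hist A S i)) @ ys' @ xs'"
    by simp
  then have "map (outcome S) (A i (hist A S i)) = map (outcome S') (A i (hist A S i))"
    by (subst (asm) append_eq_append_conv) auto
  with IH show ?case by simp
qed simp

lemma finite_cands [simp]: "finite (cands t s)"
  by (rule finite_subset[of _ "Pow {1..t}"]) (auto simp: cands_def)

lemma card_cands: "card (cands t s) = t choose s"
  using n_subsets[of "{1..t}" s] by (simp add: cands_def)

text \<open>Outcome histories form a prefix code, so padding them to a common length keeps them distinct.\<close>

lemma card_cands_le_power:
  assumes valid: "valid_alg p t s A" and n: "\<And>S. S \<in> cands t s \<Longrightarrow> num_tests p A S \<le> n"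
  shows "card (cands t s) \<le> 2 ^ n"
proof -
  define pad where "pad S = concat (hist A S p) @ replicate (n - num_tests p A S) False" for S
  have "inj_on pad (cands t s)"
  proof (rule inj_onI)
    fix S S' assume S: "S \<in> cands t s" "S' \<in> cands t s" and "pad S = pad S'"
    then have "hist A S p = hist A S' p" by (intro hist_eqI) (auto simp: pad_def)
    with valid S show "S = S'" by (auto simp: valid_alg_def)
  qed
  moreover have "pad ` cands t s \<subseteq> {xs :: bool list. set xs \<subseteq> UNIV \<and> length xs = n}"
    using n by (auto simp: pad_def num_tests_def length_concat)
  ultimately have "card (cands t s) \<le> card {xs :: bool list. set xs \<subseteq> UNIV \<and> length xs = n}"
    using finite_lists_length_eq[of "UNIV :: bool set" n] by (intro card_inj_on_le[of pad]) auto
  then show ?thesis using card_lists_length_eq[of "UNIV :: bool set" n] by simp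
qed

lemma num_tests_le_worst_tests: "S \<in> cands t s \<Longrightarrow> num_tests p A S \<le> worst_tests p t s A"
  unfolding worst_tests_def by (intro cSup_upper) auto

lemma worst_tests_le:
  assumes "\<And>S. S \<in> cands t s \<Longrightarrow> num_tests p A S \<le> n"
  shows "worst_tests p t s A \<le> n"
  using assms by (auto simp: worst_tests_def Sup_nat_def)

text \<open>A valid algorithm makes the set of worst-case counts nonempty, so its infimum is
  attained and the counting bound applies to an optimal algorithm.\<close>

lemma binomial_le_power_N:
  assumes "valid_alg p t s A"
  shows "t choose s \<le> 2 ^ N p t s"
proof -
  have "N p t s \<in> worst_tests p t s ` {A. valid_alg p t s A}"
    unfolding N_def using assms by (intro Inf_nat_def1) auto
  then obtain B where "valid_alg p t s B" "N p t s = worst_tests p t s B" by auto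
  then show ?thesis
    using card_cands_le_power[of p t s B] num_tests_le_worst_tests by (simp add: card_cands)
qed

lemma N_le:
  assumes "valid_alg p t s A" "\<And>S. S \<in> cands t s \<Longrightarrow> num_tests p A S \<le> n"
  shows "N p t s \<le> n"
proof -
  have "N p t s \<le> worst_tests p t s A" unfolding N_def using assms(1) by (intro wellorder_Inf_le1) auto
  also have "\<dots> \<le> n" using assms(2) by (rule worst_tests_le)
  finally show ?thesis .
qed

section \<open>The two-stage algorithm\<close>

text \<open>Test \<open>e\<close> of the first stage contains the samples whose codeword contains
  \<open>e\<close>, so \<open>hd h\<close> is the characteristic vector of the union of the
  defective codewords. Stages count from 0, and the third one is empty.\<close>

definition two_stage_alg :: "nat \<Rightarrow> nat \<Rightarrow> (nat \<Rightarrow> nat set) \<Rightarrow> (nat set \<Rightarrow> nat set) \<Rightarrow> alg" where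
  "two_stage_alg t M f V i h =
     (if i = 0 then map (\<lambda>e. {j \<in> {1..t}. e \<in> f j}) [0..<M]
      else if i = 1 then map (\<lambda>j. {j}) (sorted_list_of_set (V {e. e < M \<and> hd h ! e}))
      else [])"

lemma two_stage_alg:
  assumes f: "\<And>j. j \<in> {1..t} \<Longrightarrow> f j \<subseteq> {..<M}"
    and V: "\<And>Y. V Y \<subseteq> {1..t}" "\<And>Y. card (V Y) \<le> K"
    and cands: "\<And>S. S \<in> cands t s \<Longrightarrow> S \<subseteq> V (\<Union>(f ` S))"
  shows "valid_alg 3 t s (two_stage_alg t M f V)" 
    and "S \<in> cands t s \<Longrightarrow> num_tests 3 (two_stage_alg t M f V) S \<le> M + K"
proof -
  let ?A = "two_stage_alg t M f V"
  have finV: "finite (V Y)" for Y using V(1) by (rule finite_subset) simp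
  define o1 where "o1 S = map (outcome S) (map (\<lambda>e. {j \<in> {1..t}. e \<in> f j}) [0..<M])" for S
  define o2 where "o2 S = map (outcome S) (map (\<lambda>j. {j}) (sorted_list_of_set (V {e. e < M \<and> o1 S ! e})))" for S
  have hist: "hist ?A S 3 = [o1 S, o2 S, []]" for S
    by (simp add: numeral_3_eq_3 two_stage_alg_def o1_def o2_def)
  have o1: "{e. e < M \<and> o1 S ! e} = \<Union>(f ` S)" if "S \<in> cands t s" for S
    using that f by (fastforce simp: o1_def outcome_def cands_def)
  show "S \<in> cands t s \<Longrightarrow> num_tests 3 ?A S \<le> M + K"
    using V(2) by (simp add: num_tests_def hist o1_def o2_def)
  have "S = S'" if S: "S \<in> cands t s" "S' \<in> cands t s" and eq: "hist ?A S 3 = hist ?A S' 3" for S S'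
  proof -
    let ?U = "\<Union>(f ` S)"
    have e: "o1 S = o1 S'" "o2 S = o2 S'" using eq by (simp_all add: hist)
    have U: "\<Union>(f ` S') = ?U" using o1[OF S(1)] o1[OF S(2)] e by simp
    \<comment> \<open>Equal unions give equal lists of singleton tests, so the vectors
      \<open>o2\<close> can be compared entry by entry.\<close>
    have "outcome S {j} = outcome S' {j}" if "j \<in> V ?U" for j
      using e(2) that finV by (simp add: o2_def o1[OF S(1)] o1[OF S(2)] U)
    then have "S \<inter> V ?U = S' \<inter> V ?U" by (auto simp: outcome_def)
    then show ?thesis using cands[OF S(1)] cands[OF S(2)] U by auto
  qed
  moreover have "T \<subseteq> {1..t}" if "T \<in> set (?A i h)" for T i h
    using that subsetD[OF V(1)] finV by (auto simp: two_stage_alg_def split: if_splits)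
  ultimately show "valid_alg 3 t s ?A" by (simp add: valid_alg_def)
qed

section \<open>Choice of parameters and the limit\<close>

lemma log2_at_top: "filterlim (\<lambda>t::nat. log 2 (real t)) at_top sequentially"
  by real_asymp

text \<open>With \<open>M\<close> about \<open>(2 + \<epsilon>) * log 2 t\<close>,
  \<open>2 powr (M / 2)\<close> is at least \<open>t powr (1 + \<epsilon> / 2)\<close>, while
  \<open>M + 1\<close> costs at most \<open>t powr (\<epsilon> / 4)\<close>. So \<open>v\<close> is
  at most \<open>t powr (- \<epsilon> / 4)\<close>, and a constant power of it beats
  \<open>2 ^ M\<close>.\<close>

lemma eventually_parameters:
  fixes \<epsilon> :: real
  assumes \<epsilon>: "\<epsilon> > 0"
  shows "\<exists>k. \<forall>\<^sub>F t in sequentially. \<exists>M. real M \<le> (2 + \<epsilon>) * log 2 (real t) + 1 \<and>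
    2 ^ M * (real t * (M + 1) / 2 powr (M / 2)) ^ (2 * k) + t * 2 ^ M * (real t * (M + 1) / 2 powr (M / 2)) ^ k < 1"
proof -
  \<comment> \<open>Chosen so that \<open>v ^ k \<le> t powr (- (4 + \<epsilon>))\<close>: the part
    \<open>2 + \<epsilon>\<close> cancels \<open>2 ^ M\<close>, and the remaining 2 outweighs the
    factor \<open>1 + t\<close>.\<close>
  obtain k :: nat where "(4 + \<epsilon>) * 4 / \<epsilon> < k" using reals_Archimedean2 by blast
  then have k: "4 + \<epsilon> \<le> \<epsilon> / 4 * k" using \<epsilon> by (simp add: field_simps)
  have "\<forall>\<^sub>F t :: nat in sequentially. (2 + \<epsilon>) * log 2 (real t) + 2 \<le> real t powr (\<epsilon> / 4)"
    using \<epsilon> by real_asymp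
  then have "\<forall>\<^sub>F t in sequentially. \<exists>M. real M \<le> (2 + \<epsilon>) * log 2 (real t) + 1 \<and>
    2 ^ M * (real t * (M + 1) / 2 powr (M / 2)) ^ (2 * k) + t * 2 ^ M * (real t * (M + 1) / 2 powr (M / 2)) ^ k < 1"
    using eventually_gt_at_top[of "4::nat"]
  proof eventually_elim
    case (elim t)
    define L where "L = log 2 (real t)"
    have L: "L \<ge> 0" "2 powr L = t" using elim by (auto simp: L_def)
    define M where "M = nat \<lceil>(2 + \<epsilon>) * L\<rceil>"
    have "(2 + \<epsilon>) * L \<ge> 0" using L \<epsilon> by simp
    then have M: "(2 + \<epsilon>) * L \<le> M" "M \<le> (2 + \<epsilon>) * L + 1" unfolding M_def by linarith+
    define v where "v = real t * (real M + 1) / 2 powr (M / 2)"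
    have Lpowr: "2 powr (a * L) = t powr a" for a
      using L(2) by (metis mult.commute powr_powr)
    have "real M + 1 \<le> t powr (\<epsilon> / 4)" using M(2) elim by (simp add: L_def)
    moreover have "t powr (1 + \<epsilon> / 2) \<le> 2 powr (M / 2)"
      using M(1) unfolding Lpowr[symmetric] by (intro powr_mono) (auto simp: algebra_simps)
    ultimately have "v \<le> real t * t powr (\<epsilon> / 4) / t powr (1 + \<epsilon> / 2)"
      unfolding v_def using elim by (intro frac_le mult_left_mono) auto
    also have "\<dots> = t powr (1 + \<epsilon> / 4 - (1 + \<epsilon> / 2))"
      unfolding powr_diff powr_add using elim by simp
    also have "1 + \<epsilon> / 4 - (1 + \<epsilon> / 2) = - (\<epsilon> / 4)" by simp
    finally have v: "v \<le> t powr (- (\<epsilon> / 4))" .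
    have v0: "v \<ge> 0" by (simp add: v_def)
    have "t powr (- (\<epsilon> / 4)) \<le> t powr 0" using elim \<epsilon> by (intro powr_mono) auto
    then have v1: "v \<le> 1" using v elim by simp
    have "v ^ k \<le> (t powr (- (\<epsilon> / 4))) ^ k" using v v0 by (rule power_mono)
    also have "\<dots> = t powr (- (\<epsilon> / 4 * k))" using elim by (simp add: powr_powr flip: powr_realpow)
    also have "\<dots> \<le> t powr (- (4 + \<epsilon>))" using elim k by (intro powr_mono) auto
    finally have vk: "v ^ k \<le> t powr (- (4 + \<epsilon>))" .
    have v2k: "v ^ (2 * k) \<le> v ^ k" using v0 v1 by (intro power_decreasing) auto
    have "(2::real) ^ M = 2 powr M" by (simp add: powr_realpow)
    also have "\<dots> \<le> 2 powr ((2 + \<epsilon>) * L + 1)" using M(2) by (intro powr_mono) auto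
    also have "\<dots> = 2 * t powr (2 + \<epsilon>)" by (simp add: powr_add Lpowr)
    finally have M2: "(2::real) ^ M \<le> 2 * t powr (2 + \<epsilon>)" .
    have "2 ^ M * v ^ (2 * k) + t * 2 ^ M * v ^ k \<le> 2 ^ M * v ^ k + t * 2 ^ M * v ^ k"
      using v2k by simp
    also have "\<dots> = (1 + t) * (2 ^ M * v ^ k)" by (simp add: algebra_simps)
    also have "\<dots> \<le> (1 + t) * ((2 * t powr (2 + \<epsilon>)) * t powr (- (4 + \<epsilon>)))"
      using M2 vk v0 by (intro mult_left_mono mult_mono) auto
    also have "\<dots> = 2 * (1 + t) * (t powr (2 + \<epsilon>) * t powr (- (4 + \<epsilon>)))" by simp
    also have "t powr (2 + \<epsilon>) * t powr (- (4 + \<epsilon>)) = t powr (-2)" by (simp flip: powr_add)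
    also have "2 * (1 + t) * t powr (-2) = 2 * (1 + t) / t ^ 2"
      using elim(2) by (simp add: powr_minus divide_inverse)
    also have "\<dots> < 1"
    proof -
      have "4 * real t < real t * real t" using elim(2) by (intro mult_strict_right_mono) auto
      moreover have "4 < real t" using elim(2) by simp
      ultimately have "2 + 2 * real t < real t * real t" by linarith
      then show ?thesis using elim(2) by (simp add: power2_eq_square)
    qed
    finally show ?case using M(2) unfolding v_def L_def by blast
  qed
  then show ?thesis by blast
qed


text \<open>\<open>K\<close> does not depend on \<open>t\<close>, so it vanishes after division by
  \<open>log 2 t\<close>. The existence of a valid algorithm is recorded for the lower
  bound.\<close>

lemma eventually_two_stage:
  fixes \<epsilon> :: real
  assumes "\<epsilon> > 0"
  shows "\<exists>K. \<forall>\<^sub>F t in sequentially. (\<exists>A. valid_alg 3 t 2 A) \<and> real (N 3 t 2) \<le> (2 + \<epsilon>) * log 2 (real t) + real K"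
proof -
  obtain k where k: "\<forall>\<^sub>F t in sequentially. \<exists>M. real M \<le> (2 + \<epsilon>) * log 2 (real t) + 1 \<and>
    2 ^ M * (real t * (M + 1) / 2 powr (M / 2)) ^ (2 * k) + t * 2 ^ M * (real t * (M + 1) / 2 powr (M / 2)) ^ k < 1"
    using eventually_parameters[OF assms] by blast
  define K where "K = 2 * k * (k + 1)"
  \<comment> \<open>\<open>K\<close> bounds the second stage; the extra 1 comes from rounding
    \<open>M\<close> up.\<close>
  from k have "\<forall>\<^sub>F t in sequentially. (\<exists>A. valid_alg 3 t 2 A) \<and>
    real (N 3 t 2) \<le> (2 + \<epsilon>) * log 2 (real t) + real (K + 1)"
  proof eventually_elim
    case (elim t)
    then obtain M where M: "real M \<le> (2 + \<epsilon>) * log 2 (real t) + 1"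
      and small: "2 ^ M * (real t * (M + 1) / 2 powr (M / 2)) ^ (2 * k)
        + t * 2 ^ M * (real t * (M + 1) / 2 powr (M / 2)) ^ k < 1"
      by blast
    let ?I = "{1..t}"
    have small': "2 ^ M * (real (card ?I) * (M + 1) / 2 powr (M / 2)) ^ (2 * k)
        + card ?I * 2 ^ M * (real (card ?I) * (M + 1) / 2 powr (M / 2)) ^ k < 1"
      using small by (simp add: add.commute)
    obtain w f where f: "f \<in> ?I \<rightarrow> weight_sets M w"
      and avoid: "\<And>js. distinct js \<Longrightarrow> set js \<subseteq> ?I \<Longrightarrow> map f js \<notin> matching_tuples M w k"
        "\<And>js. distinct js \<Longrightarrow> set js \<subseteq> ?I \<Longrightarrow> map f js \<notin> star_tuples M w k"
      using ex_code_avoiding[OF finite_atLeastAtMost small'] by blast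
    let ?P = "\<lambda>Y V. V \<subseteq> ?I \<and> card V \<le> K \<and>
      (\<forall>i\<in>?I. \<forall>j\<in>?I. i \<noteq> j \<and> f i \<union> f j = Y \<longrightarrow> i \<in> V \<and> j \<in> V)"
    have "\<forall>Y. \<exists>V. ?P Y V"
      using few_candidates[OF finite_atLeastAtMost f avoid] unfolding K_def by blast
    then obtain V where P: "\<forall>Y. ?P Y (V Y)" using choice[of ?P] by blast
    have V: "V Y \<subseteq> ?I" "card (V Y) \<le> K" for Y using P by blast+
    have cands: "S \<subseteq> V (\<Union>(f ` S))" if S: "S \<in> cands t 2" for S
    proof -
      obtain i j where ij: "S = {i, j}" "i \<noteq> j" using S unfolding cands_def card_2_iff by blast
      then have "i \<in> ?I" "j \<in> ?I" using S by (auto simp: cands_def)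
      then show ?thesis using ij spec[OF P, of "f i \<union> f j"] by simp
    qed
    have fM: "f j \<subseteq> {..<M}" if "j \<in> ?I" for j using f that by (auto simp: weight_sets_def)
    note alg = two_stage_alg[OF fM V cands]
    have "N 3 t 2 \<le> M + K" using alg by (rule N_le)
    then have "real (N 3 t 2) \<le> real M + real K" by linarith
    with M alg(1) show ?case by auto
  qed
  then show ?thesis by blast
qed

theorem theorem1:
  shows "C 3 2 = 2"
proof -
  let ?L = "\<lambda>t. log 2 (real t)" and ?X = "\<lambda>t. real (N 3 t 2) / log 2 (real t)"
  have pos: "\<forall>\<^sub>F t in sequentially. ?L t > 0"
    using log2_at_top by (simp add: filterlim_at_top_dense)
  \<comment> \<open>The ratio converges, which gives its limsup.\<close>
  have "?X \<longlonglongrightarrow> 2"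
  proof (rule order_tendstoI)
    fix a :: real assume a: "a < 2"
    obtain K where "\<forall>\<^sub>F t in sequentially. (\<exists>A. valid_alg 3 t 2 A) \<and> real (N 3 t 2) \<le> (2 + 1) * ?L t + real K"
      using eventually_two_stage[of 1] by auto
    \<comment> \<open>Beyond this threshold \<open>2 * ?L t - 2\<close>, the logarithm of
      \<open>(t / 2)^2\<close>, exceeds \<open>a * ?L t\<close>.\<close>
    moreover have "\<forall>\<^sub>F t in sequentially. ?L t > 2 / (2 - a)"
      using log2_at_top by (simp add: filterlim_at_top_dense)
    ultimately show "\<forall>\<^sub>F t in sequentially. a < ?X t"
      using pos eventually_ge_at_top[of "2::nat"]
    proof eventually_elim
      case (elim t)
      then obtain A where "valid_alg 3 t 2 A" by blast
      then have "t choose 2 \<le> 2 ^ N 3 t 2" by (rule binomial_le_power_N)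
      then have le: "real (t choose 2) \<le> real (2 ^ N 3 t 2)" by (rule of_nat_mono)
      have "(real t / real 2) ^ 2 \<le> real (t choose 2)"
        using elim by (intro binomial_ge_n_over_k_pow_k) auto
      from order_trans[OF this le] have "(real t / 2) ^ 2 \<le> 2 ^ N 3 t 2" by simp
      then have "log 2 ((real t / 2) ^ 2) \<le> log 2 (2 ^ N 3 t 2)"
        using elim by (intro log_mono) auto
      then have "2 * ?L t - 2 \<le> real (N 3 t 2)"
        using elim by (simp add: log_nat_power log_divide algebra_simps)
      moreover have "a * ?L t < 2 * ?L t - 2" using elim a by (simp add: field_simps)
      ultimately show ?case using elim by (simp add: field_simps)
    qed
  next
    fix a :: real assume a: "a > 2"
    \<comment> \<open>Half of the excess \<open>a - 2\<close> goes into the length of the first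
      stage, the other half absorbs \<open>K\<close>.\<close>
    define \<epsilon> where "\<epsilon> = (a - 2) / 2"
    have \<epsilon>: "\<epsilon> > 0" "a = 2 + 2 * \<epsilon>" using a by (simp_all add: \<epsilon>_def field_simps)
    obtain K where "\<forall>\<^sub>F t in sequentially. (\<exists>A. valid_alg 3 t 2 A) \<and> real (N 3 t 2) \<le> (2 + \<epsilon>) * ?L t + real K"
      using eventually_two_stage[OF \<epsilon>(1)] by auto
    moreover have "\<forall>\<^sub>F t in sequentially. ?L t > real K / \<epsilon>"
      using log2_at_top by (simp add: filterlim_at_top_dense)
    ultimately show "\<forall>\<^sub>F t in sequentially. ?X t < a"
      using pos
    proof eventually_elim
      case (elim t)
      then have "real K < \<epsilon> * ?L t" using \<epsilon> by (simp add: field_simps)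
      then have "real (N 3 t 2) < a * ?L t" using elim unfolding \<epsilon>(2) by (simp add: algebra_simps)
      then show ?case using elim by (simp add: field_simps)
    qed
  qed
  then have "(\<lambda>t. ereal (?X t)) \<longlonglongrightarrow> ereal 2" by simp
  then have "limsup (\<lambda>t. ereal (?X t)) = ereal 2" by (intro lim_imp_Limsup) auto
  then show ?thesis by (simp add: C_def)
qed

end
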